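(* Let $(H_i,\vec\phi_i)$, $i=1,\dots,m$, be $\mu$-modules on pairwise disjoint vertex sets, $H_i=(V_i,E_i)$, $V_i=V_i^o\sqcup V_i^s$ (core and socket), with certificates $z^{(i)}_{vw}$. Suppose there exist $u_i\in V_i^s$ ($1\le i\le m$) such that the values $(\vec\phi_i)_{u_i}$ are all equal, say to $\phi_u$, and $$\sum_{i=1}^m\sum_{v\sim u_i}z^{(i)}_{u_iv}\in\mu\sum_{i=1}^md_{u_i}\,\mathrm{Sgn}(\phi_u),$$ where $d_{u_i}$ is the degree of $u_i$ in $H_i$. Let $H=(V,E)$ be the graph obtained from the disjoint union of the $H_i$ by identifying $u_1,\dots,u_m$ to one vertex $u$ (so $V=\bigcup_i(V_i\setminus\{u_i\})\sqcup\{u\}$, and edges $vu_i$ become $vu$), and let $\vec\phi\in\mathbb R^V$ equal $\vec\phi_i$ on $V_i\setminus\{u_i\}$ for each $i$ and $\phi_u$ at $u$. Then, up to normalizing $\vec\phi$ to satisfy $\sum_vd_v|\phi_v|=1$, $(H,\vec\phi)$ is a $\mu$-module with core $V^o=\bigcup_iV_i^o\cup\{u\}$ and socket $V^s=\bigcup_i(V_i^s\setminus\{u_i\})$.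
   Context: All graphs are finite, simple and undirected; $d_v$ is the degree of a vertex (in the graph under consideration). $\mathrm{Sgn}(t)=\{1\}$ if $t>0$, $\{-1\}$ if $t<0$, $[-1,1]$ if $t=0$. A $\mu$-module is a pair $(H,\vec\phi)$ where $H=(V_H,E_H)$ is a connected graph, $\vec\phi\in\mathbb R^{V_H}$ with $\sum_{v}d_v|\phi_v|=1$, $V_H=V_H^o\sqcup V_H^s$ (core and socket; the socket may be empty), no two vertices of $V_H^s$ are adjacent, and there exist numbers $z_{vw}\in\mathrm{Sgn}(\phi_v-\phi_w)$, $z_{wv}=-z_{vw}$ (for adjacent $v,w$) with $\sum_{w\sim v}z_{vw}\in\mu d_v\,\mathrm{Sgn}(\phi_v)$ for all $v\in V_H^o$ (degrees in $H$). Such a family $z$ is called here a certificate of the module. *)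

theory Defs
  imports Complex_Main "Graph_Theory.Digraph_Component"
begin

(* A finite simple undirected graph is a pair_graph: every edge vw is present as the two arcs
   (v, w) and (w, v). Hence out_degree is the usual degree. *)

definition nbrs :: "'a pair_pre_digraph \<Rightarrow> 'a \<Rightarrow> 'a set" where
  "nbrs H v = {w. (v, w) \<in> parcs H}"

abbreviation deg :: "'a pair_pre_digraph \<Rightarrow> 'a \<Rightarrow> nat" where
  "deg H v \<equiv> out_degree (with_proj H) v"

definition Sgn :: "real \<Rightarrow> real set" where
  "Sgn t = (if t > 0 then {1} else if t < 0 then {- 1} else {- 1..1})"

(* Functions on the vertex set are total functions; only their values on pverts H matter. *)

definition weighted_norm :: "'a pair_pre_digraph \<Rightarrow> ('a \<Rightarrow> real) \<Rightarrow> real" where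
  "weighted_norm H \<phi> = (\<Sum>v\<in>pverts H. real (deg H v) * \<bar>\<phi> v\<bar>)"

definition is_certificate ::
    "real \<Rightarrow> 'a pair_pre_digraph \<Rightarrow> ('a \<Rightarrow> real) \<Rightarrow> 'a set \<Rightarrow> ('a \<Rightarrow> 'a \<Rightarrow> real) \<Rightarrow> bool" where
  "is_certificate \<mu> H \<phi> Vo z \<longleftrightarrow>
     (\<forall>(v, w)\<in>parcs H. z v w \<in> Sgn (\<phi> v - \<phi> w) \<and> z w v = - z v w) \<and>
     (\<forall>v\<in>Vo. (\<Sum>w\<in>nbrs H v. z v w) \<in> (\<lambda>t. \<mu> * real (deg H v) * t) ` Sgn (\<phi> v))"

definition mu_module ::
    "real \<Rightarrow> 'a pair_pre_digraph \<Rightarrow> ('a \<Rightarrow> real) \<Rightarrow> 'a set \<Rightarrow> 'a set \<Rightarrow> bool" where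
  "mu_module \<mu> H \<phi> Vo Vs \<longleftrightarrow>
     pair_graph H \<and> Digraph_Component.connected (with_proj H) \<and>
     weighted_norm H \<phi> = 1 \<and>
     pverts H = Vo \<union> Vs \<and> Vo \<inter> Vs = {} \<and>
     (\<forall>v\<in>Vs. \<forall>w\<in>Vs. (v, w) \<notin> parcs H) \<and>
     (\<exists>z. is_certificate \<mu> H \<phi> Vo z)"

(* The graph obtained from the disjoint union of the H i (i in I) by identifying all the a i
   to the single vertex u; u may be a new vertex or one of the a i. *)

definition identify ::
    "'i set \<Rightarrow> ('i \<Rightarrow> 'a pair_pre_digraph) \<Rightarrow> ('i \<Rightarrow> 'a) \<Rightarrow> 'a \<Rightarrow> 'a pair_pre_digraph" where
  "identify I H a u =
     \<lparr> pverts = (\<Union>i\<in>I. pverts (H i) - {a i}) \<union> {u},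
       parcs = (\<Union>i\<in>I. map_prod (id(a i := u)) (id(a i := u)) ` parcs (H i)) \<rparr>"

definition normalize_on :: "'a pair_pre_digraph \<Rightarrow> ('a \<Rightarrow> real) \<Rightarrow> 'a \<Rightarrow> real" where
  "normalize_on H \<phi> = (\<lambda>v. \<phi> v / weighted_norm H \<phi>)"

end

theory Submission
  imports Defs
begin

text \<open>
  Since the components are disjoint and loopless, every arc of the identified graph comes from
  exactly one arc of exactly one component, so the certificates can be transported along the gluing
  maps. At a vertex other than \<open>u\<close> the core condition is the one of its component; the
  neighbours of \<open>u\<close> are the disjoint union of the neighbours of the attaching vertices, so at
  \<open>u\<close> the condition is the balance hypothesis. The weighted norm of the glued function is \<open>m\<close>,
  hence positive, and dividing by a positive number changes no sign.
\<close>

section \<open>Degrees, signs and rescaling\<close>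

lemma deg_eq_card_nbrs: "deg H v = card (nbrs H v)"
proof -
  have "out_arcs (with_proj H) v = Pair v ` nbrs H v"
    by (auto simp: out_arcs_def nbrs_def)
  then show ?thesis
    by (simp add: out_degree_def card_image inj_on_def)
qed

text \<open>As a sum of ones over neighbours, the degree becomes a special case of the neighbour
  sums, so the degree formulas for the glued graph follow from the same lemmas as the sums of
  certificate values.\<close>

lemma real_deg_eq_sum: "real (deg H v) = (\<Sum>w\<in>nbrs H v. 1)"
  by (simp add: deg_eq_card_nbrs)

lemma Sgn_divide_pos: "c > 0 \<Longrightarrow> Sgn (t / c) = Sgn t"
  by (auto simp: Sgn_def divide_simps)

lemma is_certificate_divide_pos:
  assumes "c > 0"
  shows "is_certificate \<mu> H (\<lambda>v. \<phi> v / c) Vo z \<longleftrightarrow> is_certificate \<mu> H \<phi> Vo z"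
  using assms by (simp add: is_certificate_def Sgn_divide_pos flip: diff_divide_distrib)

lemma weighted_norm_normalize_on:
  assumes "weighted_norm H \<phi> > 0"
  shows "weighted_norm H (normalize_on H \<phi>) = 1"
proof -
  have "weighted_norm H (\<lambda>v. \<phi> v / c) = weighted_norm H \<phi> / c" if "c > 0" for c
    using that by (simp add: weighted_norm_def sum_divide_distrib)
  from this[OF assms] assms show ?thesis
    by (simp add: normalize_on_def)
qed

text \<open>Purely combinatorial data of the gluing, without functions or certificates. The
  condition \<open>u_fresh\<close> lets \<open>u\<close> be either a new vertex or one of the
  \<open>a i\<close>; it only forbids a clash with a vertex that survives the
  identification.\<close>

locale vertex_identification =
  fixes I :: "'i set" and H :: "'i \<Rightarrow> 'a pair_pre_digraph" and a :: "'i \<Rightarrow> 'a" and u :: 'a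
  assumes finite_index: "finite I"
    and graph_component: "i \<in> I \<Longrightarrow> pair_graph (H i)"
    and attaching_vertex: "i \<in> I \<Longrightarrow> a i \<in> pverts (H i)"
    and disjoint_components:
      "i \<in> I \<Longrightarrow> j \<in> I \<Longrightarrow> i \<noteq> j \<Longrightarrow> pverts (H i) \<inter> pverts (H j) = {}"
    and u_fresh: "i \<in> I \<Longrightarrow> u \<notin> pverts (H i) - {a i}"
begin

section \<open>The identified graph and injectivity of the gluing maps\<close>

abbreviation G :: "'a pair_pre_digraph" where
  "G \<equiv> identify I H a u"

text \<open>On the vertices of \<open>H i\<close> this is the restriction of the quotient map from
  the disjoint union to the identified graph.\<close>

definition glue :: "'i \<Rightarrow> 'a \<Rightarrow> 'a" where
  "glue i = id(a i := u)"

lemma glue_attaching_vertex [simp]: "glue i (a i) = u"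
  by (simp add: glue_def)

lemma glue_other [simp]: "v \<noteq> a i \<Longrightarrow> glue i v = v"
  by (simp add: glue_def)

lemma parcs_G_iff:
  "(x, y) \<in> parcs G \<longleftrightarrow> (\<exists>i\<in>I. \<exists>v w. (v, w) \<in> parcs (H i) \<and> x = glue i v \<and> y = glue i w)"
proof -
  have "parcs G = (\<Union>i\<in>I. (\<lambda>(v, w). (glue i v, glue i w)) ` parcs (H i))"
    by (simp add: identify_def map_prod_def flip: glue_def)
  then show ?thesis by auto
qed

lemma glue_arc: "i \<in> I \<Longrightarrow> (v, w) \<in> parcs (H i) \<Longrightarrow> (glue i v, glue i w) \<in> parcs G"
  unfolding parcs_G_iff by blast

lemma pverts_G: "pverts G = (\<Union>i\<in>I. pverts (H i) - {a i}) \<union> {u}"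
  by (simp add: identify_def)

lemma arcD:
  assumes "i \<in> I" "(v, w) \<in> parcs (H i)"
  shows "v \<in> pverts (H i)" "w \<in> pverts (H i)" "v \<noteq> w" "(w, v) \<in> parcs (H i)"
proof -
  interpret pair_graph "H i" using assms(1) by (rule graph_component)
  show "v \<in> pverts (H i)" "w \<in> pverts (H i)"
    using assms(2) by (auto dest: in_arcsD1 in_arcsD2)
  show "v \<noteq> w" using pair_no_loops[OF assms(2)] by simp
  show "(w, v) \<in> parcs (H i)"
    using pair_sym_arcs assms(2) by (auto simp: symmetric_def sym_def)
qed

lemma finite_component:
  assumes "i \<in> I"
  shows "finite (pverts (H i))" "finite (parcs (H i))"
  using graph_component[OF assms]
  by (auto simp: pair_graph_def pair_digraph_def pair_fin_digraph_def pair_fin_digraph_axioms_def)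

lemma glue_in_pverts: "i \<in> I \<Longrightarrow> v \<in> pverts (H i) \<Longrightarrow> glue i v \<in> pverts G"
  by (cases "v = a i") (auto simp: pverts_G)

lemma glue_eq_u_iff: "i \<in> I \<Longrightarrow> v \<in> pverts (H i) \<Longrightarrow> glue i v = u \<longleftrightarrow> v = a i"
  using u_fresh[of i] by (cases "v = a i") auto

text \<open>Only attaching vertices are sent to \<open>u\<close>, so \<open>w\<close> is not
  attaching either. Both vertices are then fixed by their gluing maps, hence equal, and disjointness
  of the components gives \<open>i = j\<close>.\<close>

lemma glue_eq_glueD:
  assumes "i \<in> I" "j \<in> I" "v \<in> pverts (H i)" "w \<in> pverts (H j)" "glue i v = glue j w" "v \<noteq> a i"
  shows "i = j \<and> v = w"
proof -
  have "w \<noteq> a j" using assms glue_eq_u_iff by metis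
  with assms have "v = w" by simp
  with assms disjoint_components[of i j] show ?thesis by blast
qed

lemma inj_on_glue: "i \<in> I \<Longrightarrow> inj_on (glue i) (pverts (H i))"
  by (rule inj_onI) (metis glue_eq_glueD glue_eq_u_iff)

text \<open>A component has no loops, so some endpoint of the arc differs from \<open>a i\<close>;
  that endpoint determines the component. Hence distinct arcs never merge under the gluing.\<close>

lemma glue_arc_eqD:
  assumes "i \<in> I" "j \<in> I" "(v, w) \<in> parcs (H i)" "(v', w') \<in> parcs (H j)"
    and "glue i v = glue j v'" "glue i w = glue j w'"
  shows "i = j \<and> v = v' \<and> w = w'"
proof -
  note 1 = arcD[OF assms(1,3)] and 2 = arcD[OF assms(2,4)]
  have "i = j"
    using glue_eq_glueD[of i j v v'] glue_eq_glueD[of i j w w'] assms 1 2 by metis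
  with inj_on_glue[OF assms(1)] 1 2 assms(5,6) show ?thesis
    by (auto dest: inj_onD)
qed

section \<open>Neighbourhoods and degrees in the identified graph\<close>

lemma nbrs_G_other:
  assumes "i \<in> I" "v \<in> pverts (H i)" "v \<noteq> a i"
  shows "nbrs G v = glue i ` nbrs (H i) v"
proof (intro set_eqI iffI)
  fix y assume "y \<in> nbrs G v"
  then obtain j v' w where j: "j \<in> I" "(v', w) \<in> parcs (H j)" "v = glue j v'" "y = glue j w"
    by (auto simp: nbrs_def parcs_G_iff)
  with glue_eq_glueD[of i j v v'] arcD[OF j(1,2)] assms have "j = i" "v' = v" by simp_all
  with j(2,4) show "y \<in> glue i ` nbrs (H i) v" by (simp add: nbrs_def)
next
  fix y assume "y \<in> glue i ` nbrs (H i) v"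
  then obtain w where "(v, w) \<in> parcs (H i)" "y = glue i w" by (auto simp: nbrs_def)
  with glue_arc[OF assms(1), of v w] assms(3) show "y \<in> nbrs G v"
    by (simp add: nbrs_def)
qed

text \<open>No image under \<open>glue i\<close> appears on the right: a neighbour of
  \<open>a i\<close> differs from \<open>a i\<close>, so it is fixed by the gluing map.\<close>

lemma nbrs_G_u: "nbrs G u = (\<Union>i\<in>I. nbrs (H i) (a i))"
proof (intro set_eqI iffI)
  fix y assume "y \<in> nbrs G u"
  then obtain i v w where i: "i \<in> I" "(v, w) \<in> parcs (H i)" "u = glue i v" "y = glue i w"
    by (auto simp: nbrs_def parcs_G_iff)
  with arcD[OF i(1,2)] have "v = a i" using glue_eq_u_iff by metis
  with i arcD[OF i(1,2)] show "y \<in> (\<Union>i\<in>I. nbrs (H i) (a i))"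
    by (auto simp: nbrs_def)
next
  fix y assume "y \<in> (\<Union>i\<in>I. nbrs (H i) (a i))"
  then obtain i where i: "i \<in> I" "(a i, y) \<in> parcs (H i)"
    by (auto simp: nbrs_def)
  with arcD[OF i] have "glue i y = y" by simp
  with glue_arc[OF i] show "y \<in> nbrs G u"
    by (simp add: nbrs_def)
qed

lemma nbrs_subset_pverts: "i \<in> I \<Longrightarrow> nbrs (H i) v \<subseteq> pverts (H i)"
  by (auto simp: nbrs_def dest: arcD)

lemma sum_nbrs_G_other:
  assumes "i \<in> I" "v \<in> pverts (H i)" "v \<noteq> a i"
  shows "sum f (nbrs G v) = (\<Sum>w\<in>nbrs (H i) v. f (glue i w))"
  unfolding nbrs_G_other[OF assms]
  by (subst sum.reindex)
    (auto intro: inj_on_subset[OF inj_on_glue[OF assms(1)] nbrs_subset_pverts[OF assms(1)]])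

text \<open>The union of neighbourhoods is disjoint because the components are. The summand keeps
  the redundant \<open>glue i w\<close> so that it matches values given on glued arcs.\<close>

lemma sum_nbrs_G_u: "sum f (nbrs G u) = (\<Sum>i\<in>I. \<Sum>w\<in>nbrs (H i) (a i). f (glue i w))"
proof -
  have "sum f (nbrs G u) = (\<Sum>i\<in>I. \<Sum>w\<in>nbrs (H i) (a i). f w)"
    unfolding nbrs_G_u
  proof (rule sum.UNION_disjoint[OF finite_index])
    show "\<forall>i\<in>I. finite (nbrs (H i) (a i))"
      using finite_subset[OF nbrs_subset_pverts finite_component(1)] by simp
    show "\<forall>i\<in>I. \<forall>j\<in>I. i \<noteq> j \<longrightarrow> nbrs (H i) (a i) \<inter> nbrs (H j) (a j) = {}"
      using nbrs_subset_pverts disjoint_components by blast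
  qed
  also have "\<dots> = (\<Sum>i\<in>I. \<Sum>w\<in>nbrs (H i) (a i). f (glue i w))"
    by (intro sum.cong refl) (auto simp: nbrs_def dest: arcD(3))
  finally show ?thesis .
qed

lemma deg_G_other:
  assumes "i \<in> I" "v \<in> pverts (H i)" "v \<noteq> a i"
  shows "real (deg G v) = real (deg (H i) v)"
  by (simp only: real_deg_eq_sum sum_nbrs_G_other[OF assms])

lemma deg_G_u: "real (deg G u) = (\<Sum>i\<in>I. real (deg (H i) (a i)))"
  by (simp only: real_deg_eq_sum sum_nbrs_G_u)

section \<open>Simplicity, connectedness and weighted norm of the identified graph\<close>

lemma pair_graph_G: "pair_graph G"
proof
  show "fst e \<in> pverts G" "snd e \<in> pverts G" if "e \<in> parcs G" for e
    using that by (cases e; auto simp: parcs_G_iff intro: glue_in_pverts dest: arcD)+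
  show "finite (pverts G)" "finite (parcs G)"
    using finite_index finite_component by (auto simp: identify_def)
  show "symmetric (with_proj G)"
    unfolding symmetric_def with_proj_simps
    by (rule symI) (metis parcs_G_iff arcD(4))
  \<comment> \<open>Both endpoints come from one component, on which \<open>glue i\<close> is
    injective, so they stay distinct.\<close>
  show "fst e \<noteq> snd e" if "e \<in> parcs G" for e
  proof -
    from that obtain i v w where i: "i \<in> I" "(v, w) \<in> parcs (H i)"
      and e: "e = (glue i v, glue i w)"
      by (cases e) (auto simp: parcs_G_iff)
    with arcD[OF i] inj_on_glue[OF i(1)] show ?thesis by (auto dest: inj_onD)
  qed
qed

text \<open>Gluing maps send walks to walks. A walk from a vertex to \<open>a i\<close> inside its
  component therefore becomes a walk to \<open>u\<close>, and any two vertices are joined through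
  \<open>u\<close>.\<close>

lemma connected_G:
  assumes "\<And>i. i \<in> I \<Longrightarrow> Digraph_Component.connected (with_proj (H i))"
  shows "Digraph_Component.connected (with_proj G)"
proof -
  \<comment> \<open>Reachability along the symmetric closure of the arcs, the form in which
    \<open>connected_conv\<close> expresses connectedness.\<close>
  let ?R = "rtrancl_on (pverts G) ((parcs G)\<^sup>s)"
  have sym: "sym ?R"
    by (rule rtrancl_on_sym) (auto simp: sym_def symcl_def)
  have glue_path: "(glue i v, glue i w) \<in> ?R"
    if "i \<in> I" "(v, w) \<in> rtrancl_on (pverts (H i)) ((parcs (H i))\<^sup>s)" for i v w
    using that(2)
  proof (induction rule: rtrancl_on_induct)
    case base
    then show ?case using that(1) by (simp add: glue_in_pverts)
  next
    case (step x y)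
    then have "(glue i x, glue i y) \<in> (parcs G)\<^sup>s"
      using that(1) unfolding symcl_def by (auto intro: glue_arc)
    with step show ?case
      using that(1) by (metis rtrancl_on_into_rtrancl_on glue_in_pverts)
  qed
  have "(x, u) \<in> ?R" if "x \<in> pverts G" for x
  proof (cases "x = u")
    case True
    then show ?thesis using that by simp
  next
    case False
    with that obtain i where i: "i \<in> I" "x \<in> pverts (H i)" "x \<noteq> a i"
      by (auto simp: pverts_G)
    with assms[OF i(1)] attaching_vertex[OF i(1)]
    have "(x, a i) \<in> rtrancl_on (pverts (H i)) ((parcs (H i))\<^sup>s)"
      by (simp add: connected_conv)
    from glue_path[OF i(1) this] i show ?thesis by simp
  qed
  then have "(x, y) \<in> ?R" if "x \<in> pverts G" "y \<in> pverts G" for x y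
    using that sym by (meson rtrancl_on_trans symD)
  moreover have "pverts G \<noteq> {}" by (simp add: pverts_G)
  ultimately show ?thesis by (simp add: connected_conv)
qed

text \<open>The degree of \<open>u\<close> is the sum of the degrees of the attaching vertices, all
  of which carry the value \<open>\<psi> u\<close>. The term at \<open>u\<close> thus splits into
  exactly the terms missing from the components.\<close>

lemma weighted_norm_G:
  assumes "\<And>i v. i \<in> I \<Longrightarrow> v \<in> pverts (H i) \<Longrightarrow> \<psi> (glue i v) = \<phi> i v"
  shows "weighted_norm G \<psi> = (\<Sum>i\<in>I. weighted_norm (H i) (\<phi> i))"
proof -
  let ?f = "\<lambda>v. real (deg G v) * \<bar>\<psi> v\<bar>"
  let ?g = "\<lambda>i v. real (deg (H i) v) * \<bar>\<phi> i v\<bar>"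
  note fin = finite_component(1)
  have \<psi>_u: "\<psi> u = \<phi> i (a i)" if "i \<in> I" for i
    using assms[OF that attaching_vertex[OF that]] by simp
  have "weighted_norm G \<psi> = sum ?f (\<Union>i\<in>I. pverts (H i) - {a i}) + ?f u"
    unfolding weighted_norm_def pverts_G using fin finite_index u_fresh
    by (subst sum.union_disjoint) auto
  also have "sum ?f (\<Union>i\<in>I. pverts (H i) - {a i}) = (\<Sum>i\<in>I. sum ?f (pverts (H i) - {a i}))"
    using finite_index fin disjoint_components by (intro sum.UNION_disjoint) blast+
  also have "\<dots> = (\<Sum>i\<in>I. sum (?g i) (pverts (H i) - {a i}))"
  proof (intro sum.cong refl)
    fix i v assume *: "i \<in> I" "v \<in> pverts (H i) - {a i}"
    with assms[of i v] show "?f v = ?g i v" by (simp add: deg_G_other[of i])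
  qed
  also have "?f u = (\<Sum>i\<in>I. ?g i (a i))"
    by (simp add: deg_G_u sum_distrib_right \<psi>_u)
  also have "(\<Sum>i\<in>I. sum (?g i) (pverts (H i) - {a i})) + (\<Sum>i\<in>I. ?g i (a i)) =
      (\<Sum>i\<in>I. weighted_norm (H i) (\<phi> i))"
    unfolding weighted_norm_def sum.distrib[symmetric]
    by (intro sum.cong refl) (simp add: sum.remove[OF fin attaching_vertex])
  finally show ?thesis .
qed

section \<open>Transport of certificates\<close>

lemma ex_glued_arc_function:
  "\<exists>Z. \<forall>i\<in>I. \<forall>(v, w)\<in>parcs (H i). Z (glue i v) (glue i w) = z i v w"
proof (intro exI ballI, clarify)
  fix i v w assume *: "i \<in> I" "(v, w) \<in> parcs (H i)"
  \<comment> \<open>The value is read off from a preimage arc; \<open>glue_arc_eqD\<close> makes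
    that preimage unique. Off the arcs of \<open>G\<close> the value is left unspecified.\<close>
  show "(\<lambda>x y. THE c. \<exists>j\<in>I. \<exists>v w. (v, w) \<in> parcs (H j) \<and> x = glue j v \<and> y = glue j w \<and> c = z j v w)
      (glue i v) (glue i w) = z i v w"
  proof (rule the_equality)
    show "\<exists>j\<in>I. \<exists>v' w'. (v', w') \<in> parcs (H j) \<and> glue i v = glue j v' \<and> glue i w = glue j w' \<and>
        z i v w = z j v' w'"
      using * by blast
  next
    fix c assume "\<exists>j\<in>I. \<exists>v' w'. (v', w') \<in> parcs (H j) \<and> glue i v = glue j v' \<and>
        glue i w = glue j w' \<and> c = z j v' w'"
    then show "c = z i v w" using * glue_arc_eqD by metis
  qed
qed

text \<open>In \<open>balance\<close> a single \<open>t\<close> multiplies the total degree. This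
  agrees with adding the sets for the separate degrees, since the values of \<open>Sgn\<close> are
  convex and the degrees nonnegative.\<close>

lemma ex_certificate_G:
  assumes cert: "\<And>i. i \<in> I \<Longrightarrow> is_certificate \<mu> (H i) (\<phi> i) (Vo i) (z i)"
    and core: "\<And>i. i \<in> I \<Longrightarrow> Vo i \<subseteq> pverts (H i) - {a i}"
    and \<psi>: "\<And>i v. i \<in> I \<Longrightarrow> v \<in> pverts (H i) \<Longrightarrow> \<psi> (glue i v) = \<phi> i v"
    and balance: "(\<Sum>i\<in>I. \<Sum>v\<in>nbrs (H i) (a i). z i (a i) v)
           \<in> (\<lambda>t. \<mu> * (\<Sum>i\<in>I. real (deg (H i) (a i))) * t) ` Sgn (\<psi> u)"
  shows "\<exists>Z. is_certificate \<mu> G \<psi> ((\<Union>i\<in>I. Vo i) \<union> {u}) Z"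
proof -
  obtain Z where Z: "\<And>i v w. i \<in> I \<Longrightarrow> (v, w) \<in> parcs (H i) \<Longrightarrow> Z (glue i v) (glue i w) = z i v w"
    using ex_glued_arc_function[of z] by fast
  have arcs: "Z x y \<in> Sgn (\<psi> x - \<psi> y) \<and> Z y x = - Z x y" if xy: "(x, y) \<in> parcs G" for x y
  proof -
    from xy obtain i v w where i: "i \<in> I" "(v, w) \<in> parcs (H i)"
      and "x = glue i v" "y = glue i w"
      by (auto simp: parcs_G_iff)
    moreover from i cert[OF i(1)] have "z i v w \<in> Sgn (\<phi> i v - \<phi> i w)" "z i w v = - z i v w"
      by (auto simp: is_certificate_def)
    ultimately show ?thesis
      using arcD[OF i] by (simp add: Z \<psi>)
  qed
  have sum_other: "(\<Sum>w\<in>nbrs G v. Z v w) = (\<Sum>w\<in>nbrs (H i) v. z i v w)"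
    if "i \<in> I" "v \<in> pverts (H i)" "v \<noteq> a i" for i v
    unfolding sum_nbrs_G_other[OF that]
  proof (rule sum.cong[OF refl])
    fix w assume "w \<in> nbrs (H i) v"
    with Z[of i v w] that show "Z v (glue i w) = z i v w" by (simp add: nbrs_def)
  qed
  have sum_u: "(\<Sum>w\<in>nbrs G u. Z u w) = (\<Sum>i\<in>I. \<Sum>w\<in>nbrs (H i) (a i). z i (a i) w)"
    unfolding sum_nbrs_G_u
  proof (intro sum.cong refl)
    fix i w assume "i \<in> I" "w \<in> nbrs (H i) (a i)"
    with Z[of i "a i" w] show "Z u (glue i w) = z i (a i) w" by (simp add: nbrs_def)
  qed
  have "(\<Sum>w\<in>nbrs G v. Z v w) \<in> (\<lambda>t. \<mu> * real (deg G v) * t) ` Sgn (\<psi> v)"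
    if v: "v \<in> (\<Union>i\<in>I. Vo i) \<union> {u}" for v
  proof (cases "v = u")
    case True
    with balance show ?thesis by (simp add: sum_u deg_G_u)
  next
    case False
    with v core obtain i where i: "i \<in> I" "v \<in> Vo i" "v \<in> pverts (H i)" "v \<noteq> a i" by blast
    with cert[OF i(1)] \<psi>[OF i(1,3)] show ?thesis
      by (simp add: sum_other[OF i(1,3,4)] deg_G_other[OF i(1,3,4)] is_certificate_def)
  qed
  with arcs have "is_certificate \<mu> G \<psi> ((\<Union>i\<in>I. Vo i) \<union> {u}) Z"
    by (auto simp: is_certificate_def)
  then show ?thesis by blast
qed

end

section \<open>The module conditions for the glued pair\<close>

theorem proposition6:
  fixes \<mu> :: real and m :: nat
    and H :: "nat \<Rightarrow> 'a pair_pre_digraph" and \<phi> :: "nat \<Rightarrow> 'a \<Rightarrow> real"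
    and Vo Vs :: "nat \<Rightarrow> 'a set" and z :: "nat \<Rightarrow> 'a \<Rightarrow> 'a \<Rightarrow> real"
    and us :: "nat \<Rightarrow> 'a" and u :: 'a and \<phi>u :: real and \<psi> :: "'a \<Rightarrow> real"
  assumes "m \<ge> 1"
    and "\<And>i. i \<in> {1..m} \<Longrightarrow> mu_module \<mu> (H i) (\<phi> i) (Vo i) (Vs i)"
    and "\<And>i j. i \<in> {1..m} \<Longrightarrow> j \<in> {1..m} \<Longrightarrow> i \<noteq> j \<Longrightarrow> pverts (H i) \<inter> pverts (H j) = {}"
    and "\<And>i. i \<in> {1..m} \<Longrightarrow> is_certificate \<mu> (H i) (\<phi> i) (Vo i) (z i)"
    and "\<And>i. i \<in> {1..m} \<Longrightarrow> us i \<in> Vs i"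
    and "\<And>i. i \<in> {1..m} \<Longrightarrow> \<phi> i (us i) = \<phi>u"
    and "(\<Sum>i=1..m. \<Sum>v\<in>nbrs (H i) (us i). z i (us i) v)
           \<in> (\<lambda>t. \<mu> * (\<Sum>i=1..m. real (deg (H i) (us i))) * t) ` Sgn \<phi>u"
    and "u \<notin> (\<Union>i\<in>{1..m}. pverts (H i) - {us i})"
    and "\<And>i v. i \<in> {1..m} \<Longrightarrow> v \<in> pverts (H i) - {us i} \<Longrightarrow> \<psi> v = \<phi> i v"
    and "\<psi> u = \<phi>u"
  shows "mu_module \<mu> (identify {1..m} H us u) (normalize_on (identify {1..m} H us u) \<psi>)
           ((\<Union>i\<in>{1..m}. Vo i) \<union> {u}) (\<Union>i\<in>{1..m}. Vs i - {us i})"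
proof -
  let ?I = "{1..m}"
  note module = assms(2)[unfolded mu_module_def]
  interpret vertex_identification ?I H us u
  proof (rule vertex_identification.intro)
    show "us i \<in> pverts (H i)" "pair_graph (H i)" if "i \<in> ?I" for i
      using module[OF that] assms(5)[OF that] by blast+
    show "u \<notin> pverts (H i) - {us i}" if "i \<in> ?I" for i
      using assms(8) that by blast
  qed (use assms(1,3) in auto)
  \<comment> \<open>The common value \<open>\<phi>u\<close> is what makes this hold at the attaching
    vertices too.\<close>
  have \<psi>: "\<psi> (glue i v) = \<phi> i v" if "i \<in> ?I" "v \<in> pverts (H i)" for i v
    using that assms(6,9,10) by (cases "v = us i") auto
  have core: "Vo i \<subseteq> pverts (H i) - {us i}" if "i \<in> ?I" for i
    using module[OF that] assms(5)[OF that] by blast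
  have verts: "pverts (H i) - {us i} = Vo i \<union> (Vs i - {us i})" if "i \<in> ?I" for i
    using module[OF that] core[OF that] by blast
  have "weighted_norm G \<psi> = (\<Sum>i\<in>?I. weighted_norm (H i) (\<phi> i))"
    by (rule weighted_norm_G) (rule \<psi>)
  \<comment> \<open>Each component is normalized to weighted norm 1.\<close>
  also have "\<dots> = real m"
    using module by simp
  finally have norm_pos: "weighted_norm G \<psi> > 0" using assms(1) by simp
  from ex_certificate_G[of \<mu> \<phi> Vo z \<psi>, OF assms(4) core \<psi>] assms(7,10)
  have "\<exists>Z. is_certificate \<mu> G (normalize_on G \<psi>) ((\<Union>i\<in>?I. Vo i) \<union> {u}) Z"
    unfolding normalize_on_def is_certificate_divide_pos[OF norm_pos] by simp
  moreover have "pverts G = ((\<Union>i\<in>?I. Vo i) \<union> {u}) \<union> (\<Union>i\<in>?I. Vs i - {us i})"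
  proof -
    have "(\<Union>i\<in>?I. pverts (H i) - {us i}) = (\<Union>i\<in>?I. Vo i \<union> (Vs i - {us i}))"
      by (intro SUP_cong refl verts)
    then show ?thesis unfolding pverts_G by blast
  qed
  moreover have "((\<Union>i\<in>?I. Vo i) \<union> {u}) \<inter> (\<Union>i\<in>?I. Vs i - {us i}) = {}"
  proof -
    have "Vo i \<inter> (Vs j - {us j}) = {}" if "i \<in> ?I" "j \<in> ?I" for i j
    proof (cases "i = j")
      case True
      with module[OF that(1)] show ?thesis by blast
    next
      case False
      from assms(3)[OF that False] module[OF that(1)] module[OF that(2)] show ?thesis by blast
    qed
    \<comment> \<open>If \<open>u\<close> is one of the attaching vertices, it lies in a component
      socket, and the removal of \<open>us j\<close> is what excludes it.\<close>
    moreover have "u \<notin> Vs j - {us j}" if "j \<in> ?I" for j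
      using assms(8) verts[OF that] that by blast
    ultimately show ?thesis by blast
  qed
  moreover have "(x, y) \<notin> parcs G"
    if x: "x \<in> (\<Union>i\<in>?I. Vs i - {us i})" and y: "y \<in> (\<Union>i\<in>?I. Vs i - {us i})" for x y
  proof
    assume "(x, y) \<in> parcs G"
    then obtain i v w where i: "i \<in> ?I" "(v, w) \<in> parcs (H i)" "x = glue i v" "y = glue i w"
      unfolding parcs_G_iff by blast
    \<comment> \<open>Being a socket vertex that survives the identification,
      \<open>glue i p\<close> is fixed by \<open>glue j\<close>. Then \<open>glue_eq_glueD\<close>
      yields \<open>j = i\<close> and \<open>glue i p = p\<close>, so an arc between two sockets of
      \<open>G\<close> would lift to a forbidden arc of \<open>H i\<close>.\<close>
    have "p \<in> Vs i" if "p \<in> pverts (H i)" "glue i p \<in> (\<Union>i\<in>?I. Vs i - {us i})" for p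
    proof -
      from that(2) obtain j where j: "j \<in> ?I" "glue i p \<in> Vs j" "glue i p \<noteq> us j" by blast
      with module[OF j(1)] have "glue i p \<in> pverts (H j)" by blast
      with glue_eq_glueD[of j i "glue i p" p] i(1) j that(1) show ?thesis by simp
    qed
    with i x y arcD[OF i(1,2)] module[OF i(1)] show False by blast
  qed
  moreover have "Digraph_Component.connected (with_proj G)"
    using module by (intro connected_G) blast
  ultimately show ?thesis
    using pair_graph_G weighted_norm_normalize_on[OF norm_pos] unfolding mu_module_def by blast
qed

end
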